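(* Let $\{(\overline X^k,y^k,S^k)\}$ be any sequence generated by the algorithm STRIDE described in the context, and suppose that there exists a constant $M>0$ such that $\|y^k\|\le M$ for all $k\ge0$. If the step sizes satisfy $\sigma_k\ge c\sqrt k$ for all $k\ge1$, for some constant $c>0$, then $\{\langle C,\overline X^k\rangle\}$ converges to the optimal value of the semidefinite program (P).
   Context: $\mathbb S^n$ is the space of real symmetric $n\times n$ matrices with trace inner product $\langle\cdot,\cdot\rangle$ and Frobenius norm; $\mathbb S^n_+$ is the cone of positive semidefinite matrices. Polynomial optimization problem: $\min_{x\in\mathbb R^d}\{p(x): h_i(x)=0,\ i=1,\dots,l\}$ with real polynomials $p,h_1,\dots,h_l$, assumed feasible and bounded below. Its semidefinite (moment) relaxation, built from a vector of monomials $v:\mathbb R^d\to\mathbb R^n$ (so the matrix variable relaxes $v(x)v(x)^{\mathsf T}$), is written in the standard form (P) $\min_{X\in\mathbb S^n}\{\langle C,X\rangle:\mathcal A(X)=b,\ X\succeq0\}$, with dual (D) $\max_{y\in\mathbb R^m,S\in\mathbb S^n}\{\langle b,y\rangle:\mathcal A^*y+S=C,\ S\succeq0\}$, where $C\in\mathbb S^n$, $b\in\mathbb R^m$, $\mathcal A:\mathbb S^n\to\mathbb R^m$ is an onto linear map with adjoint $\mathcal A^*$. Standing assumption: strong duality holds and both (P) and (D) admit at least one optimal solution. Let $\mathcal F_{\mathrm P}=\{X\in\mathbb S^n:\mathcal A(X)=b,\ X\succeq0\}$. STRIDE. Input: $(X^0,y^0,S^0)\in\mathbb S^n_+\times\mathbb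 R^m\times\mathbb S^n_+$, a nondecreasing sequence of positive numbers $\{\sigma_k\}$, a nonnegative sequence $\{\varepsilon_k\}$ such that $\{k\varepsilon_k\}$ is summable, an integer $r\in[1,n]$, and a constant $\epsilon>0$. Initialize $\mathcal V=\{X^0\}$ if $X^0\in\mathcal F_{\mathrm P}$ and $\mathcal V=\emptyset$ otherwise. For $k=1,2,\dots$: Step 1 (projection): compute $\overline X^k\in\mathbb S^n_+$ (an approximate projection of $X^{k-1}-\sigma_kC$ onto $\mathcal F_{\mathrm P}$) and $(y^k,S^k)\in\mathbb R^m\times\mathbb S^n_+$ with $$\|\mathcal A(\overline X^k)-b\|\le\varepsilon_k,\qquad \mathcal A^*y^k+S^k-C-\frac1{\sigma_k}(\overline X^k-X^{k-1})=0,\qquad\langle\overline X^k,S^k\rangle=0.$$ Step 2 (certification): a stopping test, which for the asymptotic statement is taken never to be triggered (the generated sequence is infinite). Step 3 (acceleration): from the spectral decomposition $\overline X^k=\sum_{i=1}^n\lambda_iv_iv_i^{\mathsf T}$ with $\lambda_1\ge\dots\ge\lambda_n$, form points $\bar x^k_i=\mathtt{rounding}(v_i)\in\mathbb R^d$, $i=1,\dots,r$; apply a local nonlinear programming method for the polynomial problem starting at each of these to get $\hat x^k_i=\mathtt{nlp}(\bar x^k_i)$; let $\hat x^k$ be one of the $\hat x^k_i$ with the smallest value $p(\hat x^k_i)$; set $\widehat X^k=v(\hat x^k)v(\hat x^k)^{\mathsf T}$. Here $\mathtt{rounding}$ and $\mathtt{nlp}$ are arbitrary procedures returning points of $\mathbb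 R^d$; no property of them is assumed. Step 4 (policy): set $X^k=\widehat X^k$ if $\widehat X^k\in\mathcal F_{\mathrm P}$ and $$\langle C,\widehat X^k\rangle<\min\left(\langle C,\overline X^k\rangle,\ \min_{X\in\mathcal V}\langle C,X\rangle\right)-\epsilon$$ (with the minimum over an empty set equal to $+\infty$), in which case replace $\mathcal V$ by $\mathcal V\cup\{\widehat X^k\}$; otherwise set $X^k=\overline X^k$. *)

theory Defs
  imports "HOL-Analysis.Analysis"
begin

section \<open>Symmetric matrices\<close>

text \<open>
  The space of real symmetric matrices is a subset of \<^typ>\<open>real^'n^'n\<close>.  The library's
  \<^const>\<open>inner\<close> and \<^const>\<open>norm\<close> on that type are the trace inner product
  (lemma \<open>inner_matrix_eq_trace\<close>) and the Frobenius norm.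
\<close>

definition sym_matrices :: "(real^'n^'n) set" where
  "sym_matrices = {X. transpose X = X}"

definition psd_matrices :: "(real^'n^'n) set" where
  "psd_matrices = {X \<in> sym_matrices. \<forall>z. 0 \<le> z \<bullet> (X *v z)}"

definition outer :: "real^'n \<Rightarrow> real^'n^'n" where
  "outer w = (\<chi> i j. w $ i * w $ j)"

definition linear_on_sym :: "(real^'n^'n \<Rightarrow> real^'m) \<Rightarrow> bool" where
  "linear_on_sym A \<longleftrightarrow>
     (\<forall>X\<in>sym_matrices. \<forall>Y\<in>sym_matrices. A (X + Y) = A X + A Y) \<and>
     (\<forall>c. \<forall>X\<in>sym_matrices. A (c *\<^sub>R X) = c *\<^sub>R A X)"

text \<open>
  The adjoint of a map defined on symmetric matrices, again with symmetric values.  The library's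
  \<^const>\<open>adjoint\<close> is relative to the whole type, so its values need not be symmetric.
\<close>

definition adjoint_sym :: "(real^'n^'n \<Rightarrow> real^'m) \<Rightarrow> real^'m \<Rightarrow> real^'n^'n" where
  "adjoint_sym A =
     (SOME B. \<forall>y. B y \<in> sym_matrices \<and> (\<forall>X\<in>sym_matrices. A X \<bullet> y = X \<bullet> B y))"

lemma inner_matrix_eq_trace:
  fixes X Y :: "real^'n^'n"
  shows "X \<bullet> Y = trace (transpose X ** Y)"
  by (simp add: inner_vec_def trace_def matrix_matrix_mult_def transpose_def) (rule sum.swap)

lemma inner_transpose:
  fixes X Y :: "real^'n^'n"
  shows "transpose X \<bullet> transpose Y = X \<bullet> Y"
  by (simp add: inner_vec_def transpose_def) (rule sum.swap)

lemma transpose_add: "transpose (X + Y) = transpose X + transpose (Y :: real^'n^'n)"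
  by (simp add: transpose_def vec_eq_iff)

lemma adjoint_sym_works:
  fixes A :: "real^'n^'n \<Rightarrow> real^'m"
  assumes "linear_on_sym A"
  shows "adjoint_sym A y \<in> sym_matrices"
    and "X \<in> sym_matrices \<Longrightarrow> A X \<bullet> y = X \<bullet> adjoint_sym A y"
proof -
  define P :: "real^'n^'n \<Rightarrow> real^'n^'n" where "P X = (1/2) *\<^sub>R (X + transpose X)" for X
  have P_sym: "P X \<in> sym_matrices" for X
    by (simp add: P_def sym_matrices_def transpose_def vec_eq_iff add.commute)
  have P_id: "P X = X" if "X \<in> sym_matrices" for X
    using that by (simp add: P_def sym_matrices_def flip: scaleR_2)
  have P_tr: "P (transpose X) = P X" for X
    by (simp add: P_def add.commute)
  have P_add: "P (X + Y) = P X + P Y" for X Y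
    by (simp add: P_def transpose_add scaleR_add_right)
  have P_scale: "P (c *\<^sub>R X) = c *\<^sub>R P X" for c X
    by (simp add: P_def transpose_def vec_eq_iff algebra_simps)
  have lin: "linear (A \<circ> P)"
    using assms P_sym by (intro linearI) (auto simp: P_add P_scale linear_on_sym_def)
  define B where "B = adjoint (A \<circ> P)"
  have B: "Y \<bullet> B z = A (P Y) \<bullet> z" for Y z
    unfolding B_def using adjoint_works[OF lin] by simp
  have "transpose (B z) = B z" for z
  proof (rule vector_eq_rdot[THEN iffD1], rule allI)
    fix Y
    show "transpose (B z) \<bullet> Y = B z \<bullet> Y"
      by (metis B P_tr inner_commute inner_transpose transpose_transpose)
  qed
  then have "\<exists>B. \<forall>y. B y \<in> sym_matrices \<and> (\<forall>X\<in>sym_matrices. A X \<bullet> y = X \<bullet> B y)"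
    by (intro exI[of _ B]) (simp add: B P_id, simp add: sym_matrices_def)
  then have "\<forall>y. adjoint_sym A y \<in> sym_matrices \<and>
      (\<forall>X\<in>sym_matrices. A X \<bullet> y = X \<bullet> adjoint_sym A y)"
    unfolding adjoint_sym_def by (rule someI_ex)
  then show "adjoint_sym A y \<in> sym_matrices"
    and "X \<in> sym_matrices \<Longrightarrow> A X \<bullet> y = X \<bullet> adjoint_sym A y" by auto
qed


section \<open>The semidefinite program and its dual\<close>

definition primal_feasible :: "(real^'n^'n \<Rightarrow> real^'m) \<Rightarrow> real^'m \<Rightarrow> (real^'n^'n) set" where
  "primal_feasible A b = {X \<in> psd_matrices. A X = b}"

definition dual_feasible ::
    "real^'n^'n \<Rightarrow> (real^'n^'n \<Rightarrow> real^'m) \<Rightarrow> ((real^'m) \<times> (real^'n^'n)) set" where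
  "dual_feasible C A = {(y, S). adjoint_sym A y + S = C \<and> S \<in> psd_matrices}"

definition primal_value :: "real^'n^'n \<Rightarrow> (real^'n^'n \<Rightarrow> real^'m) \<Rightarrow> real^'m \<Rightarrow> real" where
  "primal_value C A b = (INF X\<in>primal_feasible A b. C \<bullet> X)"

definition dual_value :: "real^'n^'n \<Rightarrow> (real^'n^'n \<Rightarrow> real^'m) \<Rightarrow> real^'m \<Rightarrow> real" where
  "dual_value C A b = (SUP (y, S)\<in>dual_feasible C A. b \<bullet> y)"

text \<open>
  The two values are real infima and suprema; they are meaningful here because both are required
  to be attained.
\<close>

definition strong_duality_attained ::
    "real^'n^'n \<Rightarrow> (real^'n^'n \<Rightarrow> real^'m) \<Rightarrow> real^'m \<Rightarrow> bool" where
  "strong_duality_attained C A b \<longleftrightarrow>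
     (\<exists>X. is_arg_min (\<lambda>X. C \<bullet> X) (\<lambda>X. X \<in> primal_feasible A b) X) \<and>
     (\<exists>w. is_arg_max (\<lambda>(y, S). b \<bullet> y) (\<lambda>w. w \<in> dual_feasible C A) w) \<and>
     primal_value C A b = dual_value C A b"


section \<open>The polynomial problem and its relaxation\<close>

definition pop_feasible :: "(nat \<Rightarrow> real^'d \<Rightarrow> real) \<Rightarrow> nat \<Rightarrow> (real^'d) set" where
  "pop_feasible h l = {x. \<forall>i\<in>{1..l}. h i x = 0}"

definition polynomial_problem ::
    "(real^'d \<Rightarrow> real) \<Rightarrow> (nat \<Rightarrow> real^'d \<Rightarrow> real) \<Rightarrow> nat \<Rightarrow> bool" where
  "polynomial_problem p h l \<longleftrightarrow>
     real_polynomial_function p \<and> (\<forall>i\<in>{1..l}. real_polynomial_function (h i)) \<and>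
     pop_feasible h l \<noteq> {} \<and> bdd_below (p ` pop_feasible h l)"

definition monomial_vector :: "('n \<Rightarrow> 'd \<Rightarrow> nat) \<Rightarrow> real^'d \<Rightarrow> real^'n" where
  "monomial_vector \<alpha> x = (\<chi> i. \<Prod>t\<in>UNIV. (x $ t) ^ \<alpha> i t)"

text \<open>
  The affine constraints and the objective hold on, respectively agree with, the lifted feasible
  points, and the affine constraints make every matrix a moment matrix: its entries are the values
  of a normalized pseudo-moment sequence \<open>z\<close> at the products of the monomials.  No particular
  choice of the localizing constraints for the \<open>h i\<close> is fixed.
\<close>

definition moment_relaxation ::
    "(real^'d \<Rightarrow> real) \<Rightarrow> (nat \<Rightarrow> real^'d \<Rightarrow> real) \<Rightarrow> nat \<Rightarrow> ('n \<Rightarrow> 'd \<Rightarrow> nat) \<Rightarrow>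
     real^'n^'n \<Rightarrow> (real^'n^'n \<Rightarrow> real^'m) \<Rightarrow> real^'m \<Rightarrow> bool" where
  "moment_relaxation p h l \<alpha> C A b \<longleftrightarrow>
     (\<forall>x\<in>pop_feasible h l.
        A (outer (monomial_vector \<alpha> x)) = b \<and> C \<bullet> outer (monomial_vector \<alpha> x) = p x) \<and>
     (\<forall>X\<in>sym_matrices. A X = b \<longrightarrow>
        (\<exists>z. z (\<lambda>t. 0) = 1 \<and> (\<forall>i j. X $ i $ j = z (\<lambda>t. \<alpha> i t + \<alpha> j t))))"


section \<open>STRIDE\<close>

definition projection_step ::
    "real^'n^'n \<Rightarrow> (real^'n^'n \<Rightarrow> real^'m) \<Rightarrow> real^'m \<Rightarrow> real \<Rightarrow> real \<Rightarrow>
     real^'n^'n \<Rightarrow> real^'n^'n \<Rightarrow> real^'m \<Rightarrow> real^'n^'n \<Rightarrow> bool" where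
  "projection_step C A b \<sigma> \<epsilon> Xprev Xbar y S \<longleftrightarrow>
     Xbar \<in> psd_matrices \<and> S \<in> psd_matrices \<and>
     norm (A Xbar - b) \<le> \<epsilon> \<and>
     adjoint_sym A y + S - C - (1 / \<sigma>) *\<^sub>R (Xbar - Xprev) = 0 \<and>
     Xbar \<bullet> S = 0"

definition spectral_decomposition ::
    "real^'n^'n \<Rightarrow> (nat \<Rightarrow> real) \<Rightarrow> (nat \<Rightarrow> real^'n) \<Rightarrow> bool" where
  "spectral_decomposition X lam u \<longleftrightarrow>
     (\<forall>i\<in>{1..CARD('n)}. \<forall>j\<in>{1..CARD('n)}. u i \<bullet> u j = (if i = j then 1 else 0)) \<and>
     (\<forall>i\<in>{1..CARD('n)}. \<forall>j\<in>{1..CARD('n)}. i \<le> j \<longrightarrow> lam j \<le> lam i) \<and>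
     X = (\<Sum>i=1..CARD('n). lam i *\<^sub>R outer (u i))"

text \<open>
  \<open>rnd\<close> and \<open>loc\<close> are the rounding and the local optimization procedures; they receive the number
  of the eigenvector as an extra argument, and below also the iteration number, so that different
  calls may return different points (tolerances, randomization, internal state).
\<close>

definition acceleration_step ::
    "(real^'d \<Rightarrow> real) \<Rightarrow> nat \<Rightarrow> (nat \<Rightarrow> real^'n \<Rightarrow> real^'d) \<Rightarrow> (nat \<Rightarrow> real^'d \<Rightarrow> real^'d) \<Rightarrow>
     real^'n^'n \<Rightarrow> real^'d \<Rightarrow> bool" where
  "acceleration_step p r rnd loc Xbar xhat \<longleftrightarrow>
     (\<exists>lam u. spectral_decomposition Xbar lam u \<and>
        is_arg_min p (\<lambda>x. x \<in> (\<lambda>i. loc i (rnd i (u i))) ` {1..r}) xhat)"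

text \<open>Extended reals give the value \<open>\<infinity>\<close> to the minimum over the empty set.\<close>

definition accepted ::
    "real^'n^'n \<Rightarrow> (real^'n^'n \<Rightarrow> real^'m) \<Rightarrow> real^'m \<Rightarrow> real \<Rightarrow>
     (real^'n^'n) set \<Rightarrow> real^'n^'n \<Rightarrow> real^'n^'n \<Rightarrow> bool" where
  "accepted C A b \<delta> V Xbar Xhat \<longleftrightarrow>
     Xhat \<in> primal_feasible A b \<and>
     ereal (C \<bullet> Xhat) < min (ereal (C \<bullet> Xbar)) (INF X\<in>V. ereal (C \<bullet> X)) - ereal \<delta>"

text \<open>
  An infinite run.  \<open>X k\<close> and \<open>V k\<close> are the iterate and the set of stored matrices after
  iteration \<open>k\<close>; \<open>X 0\<close>, \<open>y 0\<close>, \<open>S 0\<close> are the input.  The values at \<open>0\<close> of \<open>\<sigma>\<close>, \<open>\<epsilon>\<close>,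
  \<open>Xbar\<close> and \<open>xhat\<close> play no role.
\<close>

definition stride_run ::
    "(real^'d \<Rightarrow> real) \<Rightarrow> (real^'d \<Rightarrow> real^'n) \<Rightarrow>
     real^'n^'n \<Rightarrow> (real^'n^'n \<Rightarrow> real^'m) \<Rightarrow> real^'m \<Rightarrow>
     (nat \<Rightarrow> real) \<Rightarrow> (nat \<Rightarrow> real) \<Rightarrow> nat \<Rightarrow> real \<Rightarrow>
     (nat \<Rightarrow> nat \<Rightarrow> real^'n \<Rightarrow> real^'d) \<Rightarrow> (nat \<Rightarrow> nat \<Rightarrow> real^'d \<Rightarrow> real^'d) \<Rightarrow>
     (nat \<Rightarrow> real^'n^'n) \<Rightarrow> (nat \<Rightarrow> real^'n^'n) \<Rightarrow> (nat \<Rightarrow> real^'m) \<Rightarrow> (nat \<Rightarrow> real^'n^'n) \<Rightarrow>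
     (nat \<Rightarrow> real^'d) \<Rightarrow> (nat \<Rightarrow> (real^'n^'n) set) \<Rightarrow> bool" where
  "stride_run p v C A b \<sigma> \<epsilon> r \<delta> rnd loc X Xbar y S xhat V \<longleftrightarrow>
     X 0 \<in> psd_matrices \<and> S 0 \<in> psd_matrices \<and>
     V 0 = (if X 0 \<in> primal_feasible A b then {X 0} else {}) \<and>
     (\<forall>k\<ge>1.
        projection_step C A b (\<sigma> k) (\<epsilon> k) (X (k - 1)) (Xbar k) (y k) (S k) \<and>
        acceleration_step p r (rnd k) (loc k) (Xbar k) (xhat k) \<and>
        (let Xhat = outer (v (xhat k)) in
         if accepted C A b \<delta> (V (k - 1)) (Xbar k) Xhat
         then X k = Xhat \<and> V k = V (k - 1) \<union> {Xhat}
         else X k = Xbar k \<and> V k = V (k - 1)))"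

end

theory Submission
  imports Defs
begin

text \<open>
  Accepted points are feasible and lower the objective by \<open>\<delta>\<close> each time, so acceptance happens
  finitely often and from some iteration on the algorithm is an inexact proximal point method.
  With \<open>X\<^sup>*\<close> a primal solution, \<open>(y\<^sup>*, S\<^sup>*)\<close> a dual solution and \<open>f\<^sup>*\<close> the common optimal
  value, pairing the projection equation with \<open>Xbar k - X\<^sup>*\<close> bounds
  \<open>(\<parallel>Xbar k - X\<^sup>*\<parallel>\<^sup>2 - \<parallel>Xbar (k - 1) - X\<^sup>*\<parallel>\<^sup>2) / (2 \<sigma> k)\<close> by \<open>M \<epsilon> k - (C \<bullet> Xbar k - f\<^sup>*)\<close>.
  Because \<open>\<sigma>\<close> is nondecreasing, \<open>\<parallel>Xbar k - X\<^sup>*\<parallel>\<^sup>2 / (2 \<sigma> k)\<close> is a Lyapunov function up to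
  summable errors.  Since \<open>C \<bullet> Xbar k - f\<^sup>* \<ge> - \<parallel>y\<^sup>*\<parallel> \<epsilon> k\<close> by duality, the gaps are summable.
\<close>

section \<open>Positive semidefinite matrices\<close>

lemma psd_matrices_symD: "X \<in> psd_matrices \<Longrightarrow> X \<in> sym_matrices"
  by (simp add: psd_matrices_def)

lemma sym_matrices_nth: "X \<in> sym_matrices \<Longrightarrow> X $ i $ j = X $ j $ i"
  by (simp add: sym_matrices_def transpose_def vec_eq_iff)

lemma inner_outer: "S \<bullet> outer w = w \<bullet> (S *v w)"
  by (simp add: inner_vec_def outer_def matrix_vector_mult_def sum_distrib_left mult_ac)

lemma outer_vector_mult: "outer w *v z = (w \<bullet> z) *\<^sub>R w"
  by (simp add: vec_eq_iff outer_def matrix_vector_mult_def inner_vec_def sum_distrib_left mult_ac)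

text \<open>Along a coordinate direction the quadratic form is a quadratic polynomial in
  \<open>t\<close>; suitable choices of \<open>z\<close> and \<open>t\<close> give every fact on
  entries below. \<open>X $ i\<close> is row \<open>i\<close>, by symmetry also column
  \<open>i\<close>.\<close>

lemma quadratic_form_add_axis:
  fixes X :: "real^'n^'n"
  assumes "X \<in> sym_matrices"
  shows "(z + t *\<^sub>R axis i 1) \<bullet> (X *v (z + t *\<^sub>R axis i 1)) =
    z \<bullet> (X *v z) + 2 * t * (X $ i \<bullet> z) + t\<^sup>2 * X $ i $ i"
proof -
  have col: "X *v axis i 1 = X $ i"
    using sym_matrices_nth[OF assms] by (simp add: matrix_vector_mult_basis column_def vec_eq_iff)
  have row: "(X *v z) $ i = X $ i \<bullet> z"
    by (simp add: matrix_vector_mult_def inner_vec_def)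
  show ?thesis
    by (simp add: matrix_vector_right_distrib matrix_vector_mult_scaleR inner_add_left
      inner_add_right col row inner_axis' power2_eq_square inner_commute[of z "X $ i"] algebra_simps)
qed

lemma psd_diag_nonneg: "X \<in> psd_matrices \<Longrightarrow> 0 \<le> X $ i $ i"
  using quadratic_form_add_axis[of X 0 1 i] by (simp add: psd_matrices_def) metis

text \<open>With zero diagonal the form is affine in \<open>t\<close> on each line in direction
  \<open>axis i 1\<close>; an affine function bounded below is constant, so the off-diagonal entries
  vanish.\<close>

lemma psd_zero_diag:
  fixes X :: "real^'n^'n"
  assumes X: "X \<in> psd_matrices" and diag: "\<And>i. X $ i $ i = 0"
  shows "X = 0"
proof -
  have "X $ i $ j = 0" for i j
  proof -
    \<comment> \<open>The form at \<open>axis j 1 + t *\<^sub>R axis i 1\<close> is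
      \<open>2 * t * X $ i $ j\<close>; taking \<open>t\<close> to be minus the entry makes it minus
      twice a square.\<close>
    let ?z = "axis j 1 + (- X $ i $ j) *\<^sub>R axis i (1::real)"
    have "(axis j 1 :: real^'n) \<bullet> (X *v axis j 1) = 0"
      using quadratic_form_add_axis[OF psd_matrices_symD[OF X], of 0 1 j] diag by simp
    moreover have "X $ i \<bullet> axis j 1 = X $ i $ j"
      by (simp add: inner_axis)
    ultimately have "?z \<bullet> (X *v ?z) = - 2 * (X $ i $ j)\<^sup>2"
      using quadratic_form_add_axis[OF psd_matrices_symD[OF X], of "axis j 1" "- X $ i $ j" i] diag
      by (simp add: power2_eq_square)
    moreover have "0 \<le> ?z \<bullet> (X *v ?z)"
      using X unfolding psd_matrices_def by blast
    ultimately show ?thesis by simp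
  qed
  then show ?thesis by (simp add: vec_eq_iff)
qed

text \<open>The form of the complement at \<open>z\<close> is the minimum over \<open>t\<close> of
  the form of \<open>X\<close> at \<open>z + t *\<^sub>R axis i 1\<close>, hence
  nonnegative.\<close>

lemma psd_schur_complement:
  fixes X :: "real^'n^'n"
  assumes X: "X \<in> psd_matrices" and pos: "X $ i $ i > 0"
  shows "X - (1 / X $ i $ i) *\<^sub>R outer (X $ i) \<in> psd_matrices" (is "?Y \<in> _")
proof -
  have "?Y \<in> sym_matrices"
    using psd_matrices_symD[OF X]
    by (simp add: sym_matrices_def transpose_def vec_eq_iff outer_def)
  moreover have "0 \<le> z \<bullet> (?Y *v z)" for z
  proof -
    \<comment> \<open>Completing the square: this is the vertex of the polynomial in
      \<open>quadratic_form_add_axis\<close>.\<close>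
    let ?t = "- (X $ i \<bullet> z) / X $ i $ i"
    have "0 \<le> (z + ?t *\<^sub>R axis i 1) \<bullet> (X *v (z + ?t *\<^sub>R axis i 1))"
      using X unfolding psd_matrices_def by blast
    also have "\<dots> = z \<bullet> (X *v z) - (X $ i \<bullet> z)\<^sup>2 / X $ i $ i"
      unfolding quadratic_form_add_axis[OF psd_matrices_symD[OF X]]
      using pos by (simp add: field_simps power2_eq_square)
    also have "\<dots> = z \<bullet> (?Y *v z)"
      by (simp add: matrix_vector_mult_diff_rdistrib scaleR_matrix_vector_assoc[symmetric]
        outer_vector_mult inner_diff_right power2_eq_square inner_commute[of z "X $ i"])
    finally show ?thesis .
  qed
  ultimately show ?thesis by (simp add: psd_matrices_def)
qed

text \<open>
  Symmetric Gaussian elimination writes \<open>X\<close> as a nonnegative combination of matrices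
  \<^term>\<open>outer w\<close>; each step clears a diagonal entry, and a vanishing one cannot reappear.
\<close>

lemma psd_inner_nonneg:
  fixes X S :: "real^'n^'n"
  assumes X: "X \<in> psd_matrices" and S: "S \<in> psd_matrices"
  shows "0 \<le> S \<bullet> X"
  using X
proof (induction "card {i. X $ i $ i \<noteq> 0}" arbitrary: X rule: less_induct)
  case less
  show ?case
  proof (cases "\<forall>i. X $ i $ i = 0")
    case True
    then show ?thesis using psd_zero_diag[OF less.prems] by simp
  next
    case False
    then obtain i where "X $ i $ i \<noteq> 0" by blast
    with psd_diag_nonneg[OF less.prems, of i] have pos: "X $ i $ i > 0" by simp
    define Y where "Y = X - (1 / X $ i $ i) *\<^sub>R outer (X $ i)"
    have Y: "Y \<in> psd_matrices"
      unfolding Y_def by (rule psd_schur_complement[OF less.prems pos])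
    have Yjj: "Y $ j $ j = X $ j $ j - (X $ i $ j)\<^sup>2 / X $ i $ i" for j
      by (simp add: Y_def outer_def power2_eq_square)
    have "Y $ i $ i = 0" using pos by (simp add: Yjj power2_eq_square)
    moreover have "Y $ j $ j = 0" if "X $ j $ j = 0" for j
    proof -
      have "Y $ j $ j \<le> 0" using that pos by (simp add: Yjj)
      with psd_diag_nonneg[OF Y, of j] show ?thesis by simp
    qed
    ultimately have "{j. Y $ j $ j \<noteq> 0} \<subset> {j. X $ j $ j \<noteq> 0}"
      using pos by force
    then have "card {j. Y $ j $ j \<noteq> 0} < card {j. X $ j $ j \<noteq> 0}"
      by (intro psubset_card_mono) auto
    from less.hyps[OF this Y] have "0 \<le> S \<bullet> Y" .
    moreover have "0 \<le> S \<bullet> outer (X $ i)"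
      using S by (simp add: inner_outer psd_matrices_def)
    moreover have "X = Y + (1 / X $ i $ i) *\<^sub>R outer (X $ i)"
      by (simp add: Y_def)
    then have "S \<bullet> X = S \<bullet> Y + (1 / X $ i $ i) * (S \<bullet> outer (X $ i))"
      by (metis inner_add_right inner_scaleR_right)
    ultimately show ?thesis using pos by simp
  qed
qed

section \<open>Optimal solutions\<close>

text \<open>Attainment turns the real infimum and supremum into a minimum and a maximum, so a primal
  and a dual solution share one value.\<close>

lemma strong_duality_attainedE:
  assumes "strong_duality_attained C A b"
  obtains Xs ys Ss where "Xs \<in> primal_feasible A b" "C \<bullet> Xs = primal_value C A b"
    "\<And>Y. Y \<in> primal_feasible A b \<Longrightarrow> primal_value C A b \<le> C \<bullet> Y"
    "adjoint_sym A ys + Ss = C" "Ss \<in> psd_matrices" "b \<bullet> ys = primal_value C A b"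
proof -
  obtain Xs where "is_arg_min (\<lambda>X. C \<bullet> X) (\<lambda>X. X \<in> primal_feasible A b) Xs"
    using assms unfolding strong_duality_attained_def by blast
  then have Xs: "Xs \<in> primal_feasible A b"
    and min: "\<And>Y. Y \<in> primal_feasible A b \<Longrightarrow> C \<bullet> Xs \<le> C \<bullet> Y"
    by (auto simp: is_arg_min_linorder)
  have pv: "primal_value C A b = C \<bullet> Xs"
    unfolding primal_value_def using Xs min by (intro cInf_eq_minimum) auto
  obtain w where "is_arg_max (\<lambda>(y, S). b \<bullet> y) (\<lambda>w. w \<in> dual_feasible C A) w"
    using assms unfolding strong_duality_attained_def by blast
  moreover obtain ys Ss where "w = (ys, Ss)" by (cases w)
  ultimately have ys: "(ys, Ss) \<in> dual_feasible C A"
    and max: "\<And>y S. (y, S) \<in> dual_feasible C A \<Longrightarrow> b \<bullet> y \<le> b \<bullet> ys"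
    by (auto simp: is_arg_max_linorder)
  have "dual_value C A b = b \<bullet> ys"
    unfolding dual_value_def
  proof (rule cSup_eq_maximum)
    show "b \<bullet> ys \<in> (\<lambda>(y, S). b \<bullet> y) ` dual_feasible C A"
      using ys by force
  qed (use max in auto)
  then have "b \<bullet> ys = primal_value C A b"
    using assms by (simp add: strong_duality_attained_def)
  moreover have "adjoint_sym A ys + Ss = C" "Ss \<in> psd_matrices"
    using ys by (auto simp: dual_feasible_def)
  ultimately show thesis
    using that Xs min pv by metis
qed

text \<open>Weak duality with a residual: the gap equals
  \<open>(A X - b) \<bullet> ys + Ss \<bullet> X\<close>, where the second summand is nonnegative
  and Cauchy-Schwarz controls the first.\<close>

lemma primal_gap_lower_bound:
  fixes A :: "real^'n^'n \<Rightarrow> real^'m"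
  assumes lin: "linear_on_sym A" and X: "X \<in> psd_matrices"
    and dual: "adjoint_sym A ys + Ss = C" "Ss \<in> psd_matrices"
  shows "- norm ys * norm (A X - b) \<le> C \<bullet> X - b \<bullet> ys"
proof -
  have "C \<bullet> X = A X \<bullet> ys + Ss \<bullet> X"
    unfolding dual(1)[symmetric] adjoint_sym_works(2)[OF lin psd_matrices_symD[OF X]]
    by (simp add: inner_add_left inner_add_right inner_commute)
  moreover have "0 \<le> Ss \<bullet> X" by (rule psd_inner_nonneg[OF X dual(2)])
  moreover have "- (norm (A X - b) * norm ys) \<le> (A X - b) \<bullet> ys"
    using Cauchy_Schwarz_ineq2[of "A X - b" ys] by linarith
  ultimately show ?thesis by (simp add: inner_diff_left mult.commute)
qed

section \<open>The iteration\<close>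

text \<open>After pairing with \<open>Xbar - Z\<close>, complementarity removes
  \<open>S \<bullet> Xbar\<close>, the term \<open>- S \<bullet> Z\<close> has the favorable sign,
  and infeasibility of \<open>Xbar\<close> costs at most \<open>M * e\<close>.\<close>

lemma projection_step_descent:
  fixes A :: "real^'n^'n \<Rightarrow> real^'m"
  assumes lin: "linear_on_sym A" and proj: "projection_step C A b s e Xprev Xbar y S"
    and s: "s > 0" and M: "norm y \<le> M" and Z: "Z \<in> primal_feasible A b"
  shows "(norm (Xbar - Z))\<^sup>2 / (2 * s) + (C \<bullet> Xbar - C \<bullet> Z) \<le> (norm (Xprev - Z))\<^sup>2 / (2 * s) + M * e"
proof -
  have Xbar: "Xbar \<in> psd_matrices" and S: "S \<in> psd_matrices" and res: "norm (A Xbar - b) \<le> e"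
    and eq: "adjoint_sym A y + S - C = (1 / s) *\<^sub>R (Xbar - Xprev)" and comp: "Xbar \<bullet> S = 0"
    using proj by (auto simp: projection_step_def)
  have Zpsd: "Z \<in> psd_matrices" and AZ: "A Z = b"
    using Z by (auto simp: primal_feasible_def)
  have adj: "adjoint_sym A y \<bullet> (Xbar - Z) = (A Xbar - b) \<bullet> y"
    using adjoint_sym_works(2)[OF lin psd_matrices_symD[OF Xbar], of y]
      adjoint_sym_works(2)[OF lin psd_matrices_symD[OF Zpsd], of y] AZ
    by (simp add: inner_diff_left inner_diff_right inner_commute)
  have "(A Xbar - b) \<bullet> y \<le> norm (A Xbar - b) * norm y"
    by (rule norm_cauchy_schwarz)
  \<comment> \<open>Here \<open>0 \<le> e\<close> follows from the residual bound, since
    \<open>e\<close> dominates a norm.\<close>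
  also have "\<dots> \<le> e * M"
    using res M by (intro mult_mono) (auto intro: order_trans[OF norm_ge_zero])
  finally have err: "(A Xbar - b) \<bullet> y \<le> M * e" by (simp add: mult.commute)
  have "(adjoint_sym A y + S - C) \<bullet> (Xbar - Z) =
      (A Xbar - b) \<bullet> y - S \<bullet> Z - (C \<bullet> Xbar - C \<bullet> Z)"
    using adj comp
    by (simp add: inner_add_left inner_diff_left inner_diff_right inner_commute[of Xbar S])
  also have "\<dots> \<le> M * e - (C \<bullet> Xbar - C \<bullet> Z)"
    using err psd_inner_nonneg[OF Zpsd S] by linarith
  finally have "(Xbar - Xprev) \<bullet> (Xbar - Z) / s \<le> M * e - (C \<bullet> Xbar - C \<bullet> Z)"
    unfolding eq by simp
  \<comment> \<open>Three-point identity; the squared step length on the left is nonnegative and is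
    dropped next.\<close>
  moreover have "(norm (Xbar - Z))\<^sup>2 - (norm (Xprev - Z))\<^sup>2 + (norm (Xbar - Xprev))\<^sup>2
      = 2 * ((Xbar - Xprev) \<bullet> (Xbar - Z))"
    by (simp add: power2_norm_eq_inner inner_diff_left inner_diff_right inner_commute)
  then have "((norm (Xbar - Z))\<^sup>2 - (norm (Xprev - Z))\<^sup>2) / (2 * s)
      \<le> 2 * ((Xbar - Xprev) \<bullet> (Xbar - Z)) / (2 * s)"
    using s zero_le_power2[of "norm (Xbar - Xprev)"] by (intro divide_right_mono; linarith)
  ultimately show ?thesis by (simp add: diff_divide_distrib)
qed

section \<open>Finiteness of the accepted steps\<close>

lemma accepted_decrease:
  assumes "accepted C A b \<delta> V Xbar Xhat" "Y \<in> V"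
  shows "C \<bullet> Xhat < C \<bullet> Y - \<delta>"
proof -
  have "ereal (C \<bullet> Xhat) < min (ereal (C \<bullet> Xbar)) (INF X\<in>V. ereal (C \<bullet> X)) - ereal \<delta>"
    using assms(1) by (simp add: accepted_def)
  also have "\<dots> \<le> ereal (C \<bullet> Y) - ereal \<delta>"
    using assms(2) by (intro ereal_minus_mono min.coboundedI2 INF_lower) auto
  finally show ?thesis by simp
qed

lemma stride_run_eventually_not_accepted:
  fixes X Xbar :: "nat \<Rightarrow> real^'n^'n"
  assumes run: "stride_run p v C A b \<sigma> \<epsilon> r \<delta> rnd loc X Xbar y S xhat V"
    and delta: "\<delta> > 0" and lower: "\<And>Y. Y \<in> primal_feasible A b \<Longrightarrow> L \<le> C \<bullet> Y"
  shows "\<exists>K\<ge>1. \<forall>k\<ge>K. X k = Xbar k"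
proof (rule ccontr)
  assume contra: "\<not> (\<exists>K\<ge>1. \<forall>k\<ge>K. X k = Xbar k)"
  have step: "accepted C A b \<delta> (V (k - 1)) (Xbar k) (X k) \<and> V k = V (k - 1) \<union> {X k} \<or>
      X k = Xbar k \<and> V k = V (k - 1)" if "k \<ge> 1" for k
  proof -
    let ?Xhat = "outer (v (xhat k))"
    have "if accepted C A b \<delta> (V (k - 1)) (Xbar k) ?Xhat
        then X k = ?Xhat \<and> V k = V (k - 1) \<union> {?Xhat}
        else X k = Xbar k \<and> V k = V (k - 1)"
      using run that unfolding stride_run_def Let_def by blast
    then show ?thesis by (metis (full_types))
  qed
  \<comment> \<open>Stored matrices are never discarded, so each later acceptance is compared with
    all earlier accepted points.\<close>
  have V_mono: "V j \<subseteq> V k" if "j \<le> k" for j k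
  proof (rule lift_Suc_mono_le[of V, OF _ that])
    fix n show "V n \<subseteq> V (Suc n)" using step[of "Suc n"] by auto
  qed
  have V_feas: "V k \<subseteq> primal_feasible A b" for k
  proof (induction k)
    case 0
    then show ?case using run by (simp add: stride_run_def)
  next
    case (Suc k)
    then show ?case using step[of "Suc k"] by (auto simp: accepted_def)
  qed
  have ex: "\<exists>k>j. X k \<in> V k \<and> accepted C A b \<delta> (V (k - 1)) (Xbar k) (X k)" for j
  proof -
    obtain k where "k \<ge> Suc j" "X k \<noteq> Xbar k"
      using contra by (metis le_add1 plus_1_eq_Suc)
    with step[of k] show ?thesis by (intro exI[of _ k]) auto
  qed
  \<comment> \<open>\<open>V 0\<close> may be empty, so the descending chain starts at an accepted
    iterate.\<close>
  obtain k0 where k0: "X k0 \<in> V k0"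
    using ex by blast
  \<comment> \<open>After \<open>n\<close> further acceptances some stored feasible point lies at
    least \<open>n * \<delta>\<close> lower; for large \<open>n\<close> this passes below
    \<open>L\<close>.\<close>
  have "\<exists>k. \<exists>Y\<in>V k. C \<bullet> Y \<le> C \<bullet> X k0 - real n * \<delta>" for n
  proof (induction n)
    case 0
    then show ?case using k0 by auto
  next
    case (Suc n)
    then obtain k Y where Y: "Y \<in> V k" "C \<bullet> Y \<le> C \<bullet> X k0 - real n * \<delta>" by blast
    obtain k' where k': "k' > k" "X k' \<in> V k'" "accepted C A b \<delta> (V (k' - 1)) (Xbar k') (X k')"
      using ex by blast
    from k'(1) have "k \<le> k' - 1" by simp
    with Y(1) V_mono have "Y \<in> V (k' - 1)" by blast
    from accepted_decrease[OF k'(3) this] Y(2) have "C \<bullet> X k' \<le> C \<bullet> X k0 - real (Suc n) * \<delta>"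
      by (simp add: algebra_simps)
    with k'(2) show ?case by blast
  qed
  then have bound: "L \<le> C \<bullet> X k0 - real n * \<delta>" for n
    using V_feas lower by (meson order_trans subsetD)
  obtain n where "C \<bullet> X k0 - L < real n * \<delta>"
    using reals_Archimedean3[OF delta] by blast
  with bound[of n] show False by linarith
qed

section \<open>Convergence of the inexact proximal point iteration\<close>

lemma summable_of_perturbed_descent:
  fixes E g e :: "nat \<Rightarrow> real"
  assumes E: "\<And>k. 0 \<le> E k" and g: "\<And>k. 0 \<le> g k" and e: "\<And>k. 0 \<le> e k" "summable e"
    and descent: "\<And>k. E (Suc k) + g k \<le> E k + e k"
  shows "summable g"
proof (rule summableI_nonneg_bounded[OF g])
  fix n
  \<comment> \<open>Telescoped form of \<open>descent\<close>; dropping \<open>E n\<close> bounds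
    the partial sums of \<open>g\<close>.\<close>
  have "sum g {..<n} + E n \<le> E 0 + sum e {..<n}"
  proof (induction n)
    case (Suc n)
    then show ?case using descent[of n] by simp
  qed simp
  moreover have "sum e {..<n} \<le> suminf e"
    using e by (intro sum_le_suminf) auto
  ultimately show "sum g {..<n} \<le> E 0 + suminf e"
    using E[of n] by linarith
qed

text \<open>The pure tail of a run: each output \<open>W (Suc k)\<close> is the input of the next
  projection. The parameters \<open>s k\<close>, \<open>e k\<close> belong to the step from
  \<open>W k\<close> to \<open>W (Suc k)\<close>.\<close>

lemma inexact_proximal_point_converges:
  fixes A :: "real^'n^'n \<Rightarrow> real^'m" and W :: "nat \<Rightarrow> real^'n^'n"
  assumes lin: "linear_on_sym A" and strong_duality: "strong_duality_attained C A b"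
    and proj: "\<And>k. projection_step C A b (s k) (e k) (W k) (W (Suc k)) (y k) (S k)"
    and s_pos: "\<And>k. s k > 0" and s_mono: "incseq s"
    and e_nonneg: "\<And>k. e k \<ge> 0" and e_summable: "summable e"
    and y_bounded: "\<And>k. norm (y k) \<le> M"
  shows "(\<lambda>k. C \<bullet> W k) \<longlonglongrightarrow> primal_value C A b"
proof -
  obtain Xs ys Ss where Xs: "Xs \<in> primal_feasible A b" "C \<bullet> Xs = primal_value C A b"
    and dual: "adjoint_sym A ys + Ss = C" "Ss \<in> psd_matrices" "b \<bullet> ys = primal_value C A b"
    using strong_duality by (rule strong_duality_attainedE) blast
  define E where "E k = (norm (W k - Xs))\<^sup>2 / (2 * s k)" for k
  define gap where "gap k = C \<bullet> W (Suc k) - primal_value C A b" for k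
  have M: "0 \<le> M"
    using y_bounded[of 0] norm_ge_zero order_trans by blast
  have gap_lower: "0 \<le> gap k + norm ys * e k" for k
  proof -
    have "W (Suc k) \<in> psd_matrices" and res: "norm (A (W (Suc k)) - b) \<le> e k"
      using proj[of k] by (auto simp: projection_step_def)
    from primal_gap_lower_bound[OF lin this(1) dual(1,2), of b] dual(3)
    have "- norm ys * norm (A (W (Suc k)) - b) \<le> gap k"
      by (simp add: gap_def)
    moreover have "norm ys * norm (A (W (Suc k)) - b) \<le> norm ys * e k"
      using res by (intro mult_left_mono) auto
    ultimately show ?thesis by linarith
  qed
  have descent: "E (Suc k) + gap k \<le> E k + M * e k" for k
  proof -
    \<comment> \<open>A larger step size shrinks the weight, so passing from \<open>s k\<close> to
      \<open>s (Suc k)\<close> only decreases the Lyapunov function.\<close>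
    have "E (Suc k) \<le> (norm (W (Suc k) - Xs))\<^sup>2 / (2 * s k)"
      unfolding E_def using s_pos[of k] incseq_SucD[OF s_mono, of k]
      by (intro divide_left_mono) auto
    with projection_step_descent[OF lin proj s_pos y_bounded Xs(1), of k] show ?thesis
      by (simp add: E_def gap_def Xs(2))
  qed
  \<comment> \<open>Infeasible iterates can have negative gap. Adding \<open>norm ys * e k\<close>
    to both sides of \<open>descent\<close> makes the summand nonnegative and keeps the error
    summable.\<close>
  have "summable (\<lambda>k. gap k + norm ys * e k)"
  proof (rule summable_of_perturbed_descent[where E = E and e = "\<lambda>k. (M + norm ys) * e k"])
    show "0 \<le> E k" for k
      using s_pos[of k] by (simp add: E_def)
    show "summable (\<lambda>k. (M + norm ys) * e k)"
      by (rule summable_mult[OF e_summable])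
    show "E (Suc k) + (gap k + norm ys * e k) \<le> E k + (M + norm ys) * e k" for k
      using descent[of k] by (simp add: algebra_simps)
  qed (use e_nonneg M gap_lower in auto)
  then have "summable (\<lambda>k. (gap k + norm ys * e k) - norm ys * e k)"
    by (intro summable_diff summable_mult e_summable)
  then have "gap \<longlonglongrightarrow> 0"
    using summable_LIMSEQ_zero by fastforce
  then have "(\<lambda>k. C \<bullet> W (Suc k)) \<longlonglongrightarrow> primal_value C A b"
    by (simp add: gap_def[abs_def] LIM_zero_iff)
  then show ?thesis
    by (rule LIMSEQ_imp_Suc)
qed

lemma stride_run_converges:
  fixes A :: "real^'n^'n \<Rightarrow> real^'m" and Xbar :: "nat \<Rightarrow> real^'n^'n"
  assumes A_linear: "linear_on_sym A" and strong_duality: "strong_duality_attained C A b"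
    and sigma_pos: "\<And>k. k \<ge> 1 \<Longrightarrow> \<sigma> k > 0" and sigma_mono: "mono_on {1..} \<sigma>"
    and eps_nonneg: "\<And>k. k \<ge> 1 \<Longrightarrow> \<epsilon> k \<ge> 0" and eps_summable: "summable (\<lambda>k. real k * \<epsilon> k)"
    and delta_pos: "\<delta> > 0"
    and run: "stride_run p v C A b \<sigma> \<epsilon> r \<delta> rnd loc X Xbar y S xhat V"
    and y_bounded: "\<And>k. norm (y k) \<le> M"
  shows "(\<lambda>k. C \<bullet> Xbar k) \<longlonglongrightarrow> primal_value C A b"
proof -
  have lower: "primal_value C A b \<le> C \<bullet> Y" if "Y \<in> primal_feasible A b" for Y
    using strong_duality_attainedE[OF strong_duality] that by metis
  obtain K where K: "K \<ge> 1" and X_eq: "\<And>k. k \<ge> K \<Longrightarrow> X k = Xbar k"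
    using stride_run_eventually_not_accepted[OF run delta_pos lower] by blast
  have proj: "projection_step C A b (\<sigma> k) (\<epsilon> k) (X (k - 1)) (Xbar k) (y k) (S k)" if "k \<ge> 1" for k
    using run that unfolding stride_run_def by blast
  have "summable \<epsilon>"
  proof (rule summable_comparison_test'[OF eps_summable])
    fix k :: nat assume k: "k \<ge> 1"
    then show "norm (\<epsilon> k) \<le> real k * \<epsilon> k"
      using eps_nonneg[OF k] mult_right_mono[of 1 "real k" "\<epsilon> k"] by simp
  qed
  then have eps_tail: "summable (\<lambda>k. \<epsilon> (k + Suc K))"
    by (rule summable_ignore_initial_segment)
  \<comment> \<open>Here \<open>W k\<close> is \<open>Xbar (k + K)\<close>. Iteration
    \<open>k + Suc K\<close> starts from \<open>X (k + K)\<close>, which is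
    \<open>Xbar (k + K)\<close> by the choice of \<open>K\<close>, so its parameters carry the
    offset \<open>Suc K\<close>.\<close>
  have "(\<lambda>k. C \<bullet> Xbar (k + K)) \<longlonglongrightarrow> primal_value C A b"
  proof (rule inexact_proximal_point_converges[OF A_linear strong_duality _ _ _ _ eps_tail])
    fix k
    have "projection_step C A b (\<sigma> (k + Suc K)) (\<epsilon> (k + Suc K)) (X (k + Suc K - 1))
        (Xbar (k + Suc K)) (y (k + Suc K)) (S (k + Suc K))"
      by (rule proj) simp
    then show "projection_step C A b (\<sigma> (k + Suc K)) (\<epsilon> (k + Suc K)) (Xbar (k + K))
        (Xbar (Suc k + K)) (y (k + Suc K)) (S (k + Suc K))"
      using X_eq[of "k + K"] by simp
  next
    show "incseq (\<lambda>k. \<sigma> (k + Suc K))"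
      using sigma_mono by (intro monoI) (simp add: mono_onD)
  qed (use sigma_pos eps_nonneg y_bounded in auto)
  then show ?thesis
    by (rule LIMSEQ_offset)
qed

theorem theorem2:
  fixes p :: "real^'d::finite \<Rightarrow> real"
    and h :: "nat \<Rightarrow> real^'d \<Rightarrow> real"
    and l :: nat
    and \<alpha> :: "'n::finite \<Rightarrow> 'd::finite \<Rightarrow> nat"
    and C :: "real^'n^'n"
    and A :: "real^'n^'n \<Rightarrow> real^'m"
    and b :: "real^'m"
    and \<sigma> \<epsilon> :: "nat \<Rightarrow> real"
    and r :: nat
    and \<delta> M c :: real
    and rnd :: "nat \<Rightarrow> nat \<Rightarrow> real^'n \<Rightarrow> real^'d"
    and loc :: "nat \<Rightarrow> nat \<Rightarrow> real^'d \<Rightarrow> real^'d"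
    and X Xbar S :: "nat \<Rightarrow> real^'n^'n"
    and y :: "nat \<Rightarrow> real^'m"
    and xhat :: "nat \<Rightarrow> real^'d"
    and V :: "nat \<Rightarrow> (real^'n^'n) set"
  assumes pop: "polynomial_problem p h l"
    and C_sym: "C \<in> sym_matrices"
    and A_linear: "linear_on_sym A"
    and A_onto: "A ` sym_matrices = UNIV"
    and relaxation: "moment_relaxation p h l \<alpha> C A b"
    and strong_duality: "strong_duality_attained C A b"
    and sigma_pos: "\<And>k. k \<ge> 1 \<Longrightarrow> \<sigma> k > 0"
    and sigma_mono: "mono_on {1..} \<sigma>"
    and eps_nonneg: "\<And>k. k \<ge> 1 \<Longrightarrow> \<epsilon> k \<ge> 0"
    and eps_summable: "summable (\<lambda>k. real k * \<epsilon> k)"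
    and r_range: "1 \<le> r" "r \<le> CARD('n)"
    and delta_pos: "\<delta> > 0"
    and run: "stride_run p (monomial_vector \<alpha>) C A b \<sigma> \<epsilon> r \<delta> rnd loc X Xbar y S xhat V"
    and M_pos: "M > 0"
    and y_bounded: "\<And>k. norm (y k) \<le> M"
    and c_pos: "c > 0"
    and step_size: "\<And>k. k \<ge> 1 \<Longrightarrow> \<sigma> k \<ge> c * sqrt (real k)"
  shows "(\<lambda>k. C \<bullet> Xbar k) \<longlonglongrightarrow> primal_value C A b"
  by (rule stride_run_converges[OF A_linear strong_duality sigma_pos sigma_mono eps_nonneg
    eps_summable delta_pos run y_bounded])

end
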